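(* Let $\mathbb{T}$ be a supercritical Galton--Watson tree. Then, conditioned on nonextinction (i.e. on $\mathbb{T}$ being infinite), $\imath_E^*(\mathbb{T})>0$ almost surely.
   Context: A Galton--Watson tree is the (rooted) family tree of a Galton--Watson branching process started from one individual with offspring distribution $\{p_k\}_{k\ge 0}$; it is supercritical if $\sum_k k p_k>1$. For a graph $G$ and $S\subset V(G)$, $|S|$ is the cardinality of $S$, and $\partial S$ is the set of edges of $G$ with one end in $S$ and the other in $S^c$. $S$ is connected if the subgraph induced on $S$ is connected. For an infinite connected graph $G$ with basepoint $o$ (for $\mathbb{T}$, the root), the anchored expansion constant is $$\imath_E^*(G):=\lim_{n\to\infty}\inf\left\{\frac{|\partial S|}{|S|}: o\in S\subset V(G),\ S\text{ is connected},\ n\le |S|<\infty\right\};$$ it does not depend on the choice of $o$. *)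

theory Defs
  imports "HOL-Probability.Probability"
begin

text \<open>A simple undirected graph is given by its vertex set \<open>V\<close> and its set \<open>E\<close> of two-element
  edges.\<close>

definition edge_boundary :: "'a set \<Rightarrow> 'a set set \<Rightarrow> 'a set \<Rightarrow> 'a set set" where
  "edge_boundary V E S = {e \<in> E. \<exists>u\<in>S. \<exists>v\<in>V - S. e = {u, v}}"

definition induces_connected :: "'a set set \<Rightarrow> 'a set \<Rightarrow> bool" where
  "induces_connected E S \<longleftrightarrow>
     (\<forall>u\<in>S. \<forall>v\<in>S. (u, v) \<in> {(x, y). x \<in> S \<and> y \<in> S \<and> {x, y} \<in> E}\<^sup>*)"

text \<open>The value lies in \<open>[0, \<infinity>]\<close>: the infima increase with \<open>n\<close>, so the limit always exists there,
  but it may be infinite. The boundary is counted with the counting measure, because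
  \<^const>\<open>card\<close> would assign 0 to an infinite boundary.\<close>

definition anchored_expansion :: "'a set \<Rightarrow> 'a set set \<Rightarrow> 'a \<Rightarrow> ennreal" where
  "anchored_expansion V E b =
     lim (\<lambda>n::nat. INF S \<in> {S. b \<in> S \<and> S \<subseteq> V \<and> induces_connected E S \<and> finite S \<and> n \<le> card S}.
            emeasure (count_space UNIV) (edge_boundary V E S) / of_nat (card S))"

text \<open>Family trees in Ulam--Harris labelling: the root is \<open>[]\<close>, and an individual \<open>v\<close> of the tree
  with \<open>c v\<close> children has the children \<open>v @ [0], \<dots>, v @ [c v - 1]\<close>. The values of \<open>c\<close> at labels
  outside the tree are irrelevant.\<close>

inductive_set family_tree :: "(nat list \<Rightarrow> nat) \<Rightarrow> nat list set" for c :: "nat list \<Rightarrow> nat" where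
  root: "[] \<in> family_tree c"
| child: "v \<in> family_tree c \<Longrightarrow> i < c v \<Longrightarrow> v @ [i] \<in> family_tree c"

definition family_edges :: "(nat list \<Rightarrow> nat) \<Rightarrow> nat list set set" where
  "family_edges c = {{v, v @ [i]} | v i. v \<in> family_tree c \<and> i < c v}"

text \<open>The variables \<open>\<xi> v\<close> are the offspring numbers of the potential individuals, so the
  Galton--Watson tree at \<open>\<omega>\<close> is \<open>family_tree (\<lambda>v. \<xi> v \<omega>)\<close>.\<close>

definition galton_watson :: "'w measure \<Rightarrow> nat pmf \<Rightarrow> (nat list \<Rightarrow> 'w \<Rightarrow> nat) \<Rightarrow> bool" where
  "galton_watson M p \<xi> \<longleftrightarrow>
     prob_space M \<and>
     prob_space.indep_vars M (\<lambda>_. count_space UNIV) \<xi> UNIV \<and>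
     (\<forall>v. distr M (count_space UNIV) (\<xi> v) = measure_pmf p)"

text \<open>The mean is taken in \<^typ>\<open>ennreal\<close>, so an infinite mean counts as supercritical.\<close>

definition supercritical :: "nat pmf \<Rightarrow> bool" where
  "supercritical p \<longleftrightarrow> (\<Sum>k. ennreal (real k * pmf p k)) > 1"

end

theory Submission
  imports Defs "HOL-Library.Sublist"
begin

text \<open>The proof is a first-moment bound on the number of finite subtrees, weighted by their size and
  their boundary. Let \<open>f\<close> be the probability generating function of the offspring law. A finite
  connected set \<open>S\<close> of vertices of the family tree that contains the root is a subtree closed under
  taking parents. For \<open>x > 1\<close> and \<open>0 < y < 1\<close> give it the weight \<open>x ^ |S| * y ^ |\<partial>S|\<close>. The expectation
  \<open>Z\<close> of the sum of these weights over all \<open>S\<close> satisfies \<open>Z = x * f (y + Z)\<close>, since a child of the root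
  either contributes an edge to the boundary or is the root of a subtree of its own. Hence
  \<open>Z \<le> z\<close> for every \<open>z \<ge> 0\<close> with \<open>x * f (y + z) \<le> z\<close>, by induction on a bound for the height.

  Such parameters exist: in the supercritical case \<open>f s < s\<close> for some \<open>0 < s < 1\<close>, because
  \<open>f 1 = 1\<close> and the slope of \<open>f\<close> at 1 exceeds 1, and one can split \<open>s = y + z\<close> with
  \<open>f s < z < s\<close> and take \<open>x = z / f s\<close> (\<open>supercritical_parameters\<close>).

  So the sum of the weights is almost surely finite (\<open>AE_sum_subtree_weight_finite\<close>). Choose \<open>K\<close> with
  \<open>x ^ K * y \<ge> 1\<close>. Every \<open>S\<close> with \<open>K * |\<partial>S| \<le> |S|\<close> has weight at least 1, so there are only
  finitely many of them, and \<open>|\<partial>S| / |S| \<ge> 1 / K\<close> once \<open>|S|\<close> is large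
  (\<open>anchored_expansion_pos\<close>). This holds almost surely without conditioning; on extinction the
  infima over large \<open>S\<close> are over the empty set.

  Instead of solving the recursion for a random sum, independence is used once for each fixed \<open>S\<close>
  (\<open>nn_integral_subtree_weight\<close>): the expected weight is a product over \<open>v \<in> S\<close> of a factor that
  depends only on which children of \<open>v\<close> lie in \<open>S\<close>. The sum of these products is bounded
  deterministically in \<open>sum_bounded_subtrees_le\<close>.\<close>

section \<open>Finite subtrees of the tree of labels\<close>

text \<open>The indices \<open>i\<close> of those children \<open>v @ [i]\<close> of \<open>v\<close> that belong to \<open>S\<close>.\<close>

definition child_set :: "nat list set \<Rightarrow> nat list \<Rightarrow> nat set" where
  "child_set S v = {i. v @ [i] \<in> S}"

text \<open>A set of labels that contains the root and is closed under taking parents.\<close>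

definition rooted_subtree :: "nat list set \<Rightarrow> bool" where
  "rooted_subtree S \<longleftrightarrow> [] \<in> S \<and> (\<forall>v i. v @ [i] \<in> S \<longrightarrow> v \<in> S)"

text \<open>Height and width are both bounded, so that there are only finitely many such subtrees and all
  sums are finite.\<close>

definition bounded_subtrees :: "nat \<Rightarrow> nat \<Rightarrow> nat list set set" where
  "bounded_subtrees w h = {S. rooted_subtree S \<and> S \<subseteq> {v. length v < h \<and> set v \<subseteq> {..<w}}}"

text \<open>The subtree whose root has the child set \<open>D\<close> and which carries the subtree \<open>f i\<close> at its child \<open>i\<close>.\<close>

definition graft :: "nat set \<Rightarrow> (nat \<Rightarrow> nat list set) \<Rightarrow> nat list set" where
  "graft D f = insert [] (\<Union>i\<in>D. (#) i ` f i)"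

lemma finite_labels: "finite {v :: nat list. length v < h \<and> set v \<subseteq> {..<w}}"
proof (rule finite_subset)
  show "{v :: nat list. length v < h \<and> set v \<subseteq> {..<w}}
      \<subseteq> {v. set v \<subseteq> {..<w} \<and> length v \<le> h}" by auto
qed (rule finite_lists_length_le, simp)

lemma finite_bounded_subtrees: "finite (bounded_subtrees w h)"
  by (rule finite_subset[of _ "Pow {v. length v < h \<and> set v \<subseteq> {..<w}}"])
     (auto simp: bounded_subtrees_def finite_labels)

lemma finite_if_in_bounded_subtrees: "S \<in> bounded_subtrees w h \<Longrightarrow> finite S"
  unfolding bounded_subtrees_def by (blast intro: finite_subset[OF _ finite_labels])

lemma bounded_subtrees_mono: "w \<le> w' \<Longrightarrow> h \<le> h' \<Longrightarrow> bounded_subtrees w h \<subseteq> bounded_subtrees w' h'"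
  unfolding bounded_subtrees_def by fastforce

lemma finite_rooted_subtree_in_bounded_subtrees:
  assumes "rooted_subtree S" "finite S"
  shows "\<exists>n. S \<in> bounded_subtrees n n"
proof -
  define n where "n = Suc (Max (insert 0 (length ` S \<union> \<Union> (set ` S))))"
  have fin: "finite (insert 0 (length ` S \<union> \<Union> (set ` S)))" using assms by auto
  have "length v < n" "set v \<subseteq> {..<n}" if "v \<in> S" for v
    using that fin by (auto simp: n_def less_Suc_eq_le intro!: Max_ge)
  with assms show ?thesis by (auto simp: bounded_subtrees_def)
qed

lemma rooted_subtree_prefix: "rooted_subtree S \<Longrightarrow> u @ v \<in> S \<Longrightarrow> u \<in> S"
  by (induction v rule: rev_induct) (auto simp: rooted_subtree_def simp flip: append_assoc)

lemma bounded_subtrees_Suc_subset: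
  "bounded_subtrees w (Suc h) \<subseteq>
     (\<lambda>(D, f). graft D f) ` (SIGMA D:Pow {..<w}. PiE D (\<lambda>_. bounded_subtrees w h))"
proof
  fix S assume S: "S \<in> bounded_subtrees w (Suc h)"
  hence rt: "rooted_subtree S" and sub: "S \<subseteq> {v. length v < Suc h \<and> set v \<subseteq> {..<w}}"
    by (auto simp: bounded_subtrees_def)
  define D where "D = child_set S []"
  define f where "f = (\<lambda>i\<in>D. {v. i # v \<in> S})"
  have D: "D \<subseteq> {..<w}" using sub by (auto simp: D_def child_set_def)
  have root: "i \<in> D" if "i # v \<in> S" for i v
    using rooted_subtree_prefix[OF rt, of "[i]" v] that by (simp add: D_def child_set_def)
  have "f i \<in> bounded_subtrees w h" if i: "i \<in> D" for i
  proof -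
    have "rooted_subtree {v. i # v \<in> S}"
      using i rt unfolding rooted_subtree_def D_def child_set_def
      by (metis append_Cons append_Nil mem_Collect_eq)
    moreover have "{v. i # v \<in> S} \<subseteq> {v. length v < h \<and> set v \<subseteq> {..<w}}"
    proof safe
      fix v assume "i # v \<in> S"
      hence "length (i # v) < Suc h" "set (i # v) \<subseteq> {..<w}" using sub by blast+
      thus "length v < h" "\<And>j. j \<in> set v \<Longrightarrow> j < w" by auto
    qed
    ultimately show ?thesis using i by (simp add: bounded_subtrees_def f_def)
  qed
  hence f: "f \<in> PiE D (\<lambda>_. bounded_subtrees w h)" by (auto simp: f_def)
  have "S = graft D f"
  proof (rule set_eqI)
    fix u show "u \<in> S \<longleftrightarrow> u \<in> graft D f"
      using rt root by (cases u) (auto simp: graft_def f_def rooted_subtree_def)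
  qed
  thus "S \<in> (\<lambda>(D, f). graft D f) ` (SIGMA D:Pow {..<w}. PiE D (\<lambda>_. bounded_subtrees w h))"
    using D f by (intro image_eqI[of _ _ "(D, f)"]) auto
qed

lemma prod_graft:
  fixes G :: "nat set \<Rightarrow> 'b :: comm_monoid_mult"
  assumes "finite D" and f: "\<And>i. i \<in> D \<Longrightarrow> finite (f i) \<and> [] \<in> f i"
  shows "(\<Prod>v\<in>graft D f. G (child_set (graft D f) v)) =
         G D * (\<Prod>i\<in>D. \<Prod>v\<in>f i. G (child_set (f i) v))"
proof -
  have root: "child_set (graft D f) [] = D"
    using f by (auto simp: child_set_def graft_def)
  have sub: "child_set (graft D f) (i # v) = child_set (f i) v" if "i \<in> D" for i v
    using that by (auto simp: child_set_def graft_def)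
  have "(\<Prod>v\<in>graft D f. G (child_set (graft D f) v)) =
        G D * (\<Prod>v\<in>(\<Union>i\<in>D. (#) i ` f i). G (child_set (graft D f) v))"
    using assms by (subst (1) graft_def, subst prod.insert) (auto simp: root)
  also have "(\<Prod>v\<in>(\<Union>i\<in>D. (#) i ` f i). G (child_set (graft D f) v)) =
      (\<Prod>i\<in>D. \<Prod>v\<in>(#) i ` f i. G (child_set (graft D f) v))"
    using assms by (intro prod.UNION_disjoint) auto
  also have "\<dots> = (\<Prod>i\<in>D. \<Prod>v\<in>f i. G (child_set (f i) v))"
    by (rule prod.cong[OF refl]) (simp add: prod.reindex sub)
  finally show ?thesis .
qed

text \<open>The recursion for the total weight, as an inequality: a supersolution \<open>z\<close> of
  \<open>Z = (\<Sum>D. G D * Z ^ card D)\<close> dominates the sum over all subtrees of any height. The bound does not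
  depend on the height or, if the hypothesis holds for all \<open>w\<close>, on the width.\<close>

lemma sum_bounded_subtrees_le:
  fixes G :: "nat set \<Rightarrow> ennreal"
  assumes z: "(\<Sum>D\<in>Pow {..<w}. G D * z ^ card D) \<le> z"
  shows "(\<Sum>S\<in>bounded_subtrees w h. \<Prod>v\<in>S. G (child_set S v)) \<le> z"
proof (induction h)
  case 0
  have "bounded_subtrees w 0 = {}" by (auto simp: bounded_subtrees_def rooted_subtree_def)
  thus ?case by simp
next
  case (Suc h)
  let ?W = "\<lambda>S. \<Prod>v\<in>S. G (child_set S v)"
  let ?A = "SIGMA D:Pow {..<w}. PiE D (\<lambda>_. bounded_subtrees w h)"
  have finA: "finite ?A"
    by (intro finite_SigmaI finite_PiE) (auto intro: finite_subset finite_bounded_subtrees)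
  \<comment> \<open>Grafting is in fact injective here, but for an upper bound surjectivity suffices.\<close>
  have "(\<Sum>S\<in>bounded_subtrees w (Suc h). ?W S) \<le> (\<Sum>S\<in>(\<lambda>(D, f). graft D f) ` ?A. ?W S)"
    by (intro sum_mono2 bounded_subtrees_Suc_subset finite_imageI finA) auto
  also have "\<dots> \<le> (\<Sum>(D, f)\<in>?A. ?W (graft D f))"
    using sum_image_le[OF finA, of ?W "\<lambda>(D, f). graft D f"]
    by (simp add: o_def case_prod_unfold)
  also have "\<dots> = (\<Sum>(D, f)\<in>?A. G D * (\<Prod>i\<in>D. ?W (f i)))"
  proof (intro sum.cong refl, safe)
    fix D f assume D: "D \<subseteq> {..<w}" and f: "f \<in> PiE D (\<lambda>_. bounded_subtrees w h)"
    show "?W (graft D f) = G D * (\<Prod>i\<in>D. ?W (f i))"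
    proof (rule prod_graft)
      show "finite D" using D by (rule finite_subset) simp
      fix i assume "i \<in> D"
      hence "f i \<in> bounded_subtrees w h" using f by auto
      thus "finite (f i) \<and> [] \<in> f i"
        using finite_if_in_bounded_subtrees by (auto simp: bounded_subtrees_def rooted_subtree_def)
    qed
  qed
  also have "\<dots> = (\<Sum>D\<in>Pow {..<w}. \<Sum>f\<in>PiE D (\<lambda>_. bounded_subtrees w h). G D * (\<Prod>i\<in>D. ?W (f i)))"
    by (subst sum.Sigma) (auto intro!: finite_PiE finite_bounded_subtrees intro: finite_subset)
  also have "\<dots> = (\<Sum>D\<in>Pow {..<w}. G D * (\<Sum>S\<in>bounded_subtrees w h. ?W S) ^ card D)"
  proof (intro sum.cong refl)
    fix D assume "D \<in> Pow {..<w}"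
    hence "finite D" by (auto intro: finite_subset)
    hence "(\<Prod>i\<in>D. \<Sum>S\<in>bounded_subtrees w h. ?W S) =
        (\<Sum>f\<in>PiE D (\<lambda>_. bounded_subtrees w h). \<Prod>i\<in>D. ?W (f i))"
      by (rule prod_sum_PiE) (rule finite_bounded_subtrees)
    thus "(\<Sum>f\<in>PiE D (\<lambda>_. bounded_subtrees w h). G D * (\<Prod>i\<in>D. ?W (f i))) =
        G D * (\<Sum>S\<in>bounded_subtrees w h. ?W S) ^ card D"
      by (simp add: sum_distrib_left)
  qed
  also have "\<dots> \<le> (\<Sum>D\<in>Pow {..<w}. G D * z ^ card D)"
    by (intro sum_mono mult_left_mono power_mono Suc.IH) auto
  finally show ?case using z by (rule order_trans)
qed

section \<open>The weight of a vertex\<close>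

text \<open>The factor contributed by a vertex with \<open>k\<close> children of which those with index in \<open>D\<close> belong to
  the subtree: \<open>x\<close> for the vertex itself and \<open>y\<close> for each child left outside. It vanishes if \<open>D\<close>
  contains an index that is not the index of a child, so that only subtrees of the family tree
  carry positive weight.\<close>

definition offspring_weight :: "real \<Rightarrow> real \<Rightarrow> nat set \<Rightarrow> nat \<Rightarrow> ennreal" where
  "offspring_weight x y D k = (if D \<subseteq> {..<k} then ennreal (x * y ^ (k - card D)) else 0)"

text \<open>Up to the truncation of the width, this is the binomial theorem: each of the \<open>k\<close> children
  contributes \<open>y\<close> or \<open>z\<close>.\<close>

lemma sum_offspring_weight_le:
  assumes "x \<ge> 0" "y \<ge> 0" "z \<ge> 0"
  shows "(\<Sum>D\<in>Pow {..<w}. offspring_weight x y D k * ennreal z ^ card D)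
           \<le> ennreal (x * (y + z) ^ k)"
proof -
  have "(\<Sum>D\<in>Pow {..<w}. offspring_weight x y D k * ennreal z ^ card D)
      = (\<Sum>D\<in>Pow {..<w} \<inter> Pow {..<k}. ennreal (x * (z ^ card D * y ^ (k - card D))))"
    using assms by (subst sum.inter_restrict)
      (auto intro!: sum.cong simp: offspring_weight_def ennreal_power mult_ac simp flip: ennreal_mult)
  also have "\<dots> \<le> (\<Sum>D\<in>Pow {..<k}. ennreal (x * (z ^ card D * y ^ (k - card D))))"
    by (intro sum_mono2) auto
  also have "\<dots> = ennreal (x * (\<Sum>D\<in>Pow {..<k}. z ^ card D * y ^ (k - card D)))"
    using assms by (simp add: sum_ennreal sum_distrib_left)
  also have "(\<Sum>D\<in>Pow {..<k}. z ^ card D * y ^ (k - card D)) =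
      (\<Sum>D\<in>Pow {..<k}. (\<Prod>i\<in>D. z) * (\<Prod>i\<in>{..<k} - D. y))"
    by (intro sum.cong refl) (auto simp: card_Diff_subset finite_subset)
  also have "\<dots> = (y + z) ^ k"
    by (subst prod_add[symmetric]) (auto simp: add.commute)
  finally show ?thesis .
qed

section \<open>Generating function of a supercritical offspring law\<close>

text \<open>The probability generating function of \<open>p\<close>; it is used for arguments in \<open>[0, 1]\<close> only, where the
  integrand is bounded.\<close>

definition pgf :: "nat pmf \<Rightarrow> real \<Rightarrow> real" where
  "pgf p s = measure_pmf.expectation p (\<lambda>k. s ^ k)"

lemma integrable_pow_pmf:
  fixes s :: real
  assumes "0 \<le> s" "s \<le> 1"
  shows "integrable (measure_pmf p) (\<lambda>k. s ^ k)"
  using assms by (intro measure_pmf.integrable_const_bound[where B=1]) (auto simp: power_le_one)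

lemma supercritical_pgf_less:
  assumes "supercritical p"
  shows "\<exists>s. 0 < s \<and> s < 1 \<and> pgf p s < s"
proof -
  let ?m = "\<lambda>N. \<Sum>k<N. real k * pmf p k"
  have "(SUP N. \<Sum>k<N. ennreal (real k * pmf p k)) > 1"
    using assms by (simp add: supercritical_def suminf_eq_SUP)
  then obtain N where "1 < (\<Sum>k<N. ennreal (real k * pmf p k))"
    by (auto simp: less_SUP_iff)
  hence N: "?m N > 1" by (simp add: sum_ennreal)
  \<comment> \<open>The mean may be infinite, so the derivative at 1 is taken of a finite partial sum only:
    \<open>\<phi> s\<close> is a lower bound for \<open>s - pgf p s\<close>, vanishes at 1 and has negative slope there.\<close>
  define \<phi> where "\<phi> s = (\<Sum>k<N. (1 - s ^ k) * pmf p k) - (1 - s)" for s :: real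
  have "(\<phi> has_real_derivative (\<Sum>k<N. (0 - real k * 1 ^ (k - 1)) * pmf p k) - (0 - 1)) (at 1)"
    unfolding \<phi>_def by (auto intro!: derivative_eq_intros sum.cong)
  also have "(\<Sum>k<N. (0 - real k * 1 ^ (k - 1)) * pmf p k) - (0 - 1) = 1 - ?m N"
    by (simp add: sum_negf)
  finally obtain d where d: "d > 0" "\<And>h. h > 0 \<Longrightarrow> h < d \<Longrightarrow> \<phi> 1 < \<phi> (1 - h)"
    using DERIV_neg_dec_left[of \<phi> "1 - ?m N" 1] N by auto
  define s where "s = 1 - min d 1 / 2"
  have s: "0 < s" "s < 1" using d(1) by (auto simp: s_def)
  have "\<phi> s > 0" using d(2)[of "min d 1 / 2"] d(1) by (auto simp: s_def \<phi>_def)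
  have "pgf p s + (\<Sum>k<N. (1 - s ^ k) * pmf p k) =
     measure_pmf.expectation p (\<lambda>k. s ^ k + (1 - s ^ k) * indicator {..<N} k)"
  proof -
    have 1: "measure_pmf.expectation p (\<lambda>k. (1 - s ^ k) * indicator {..<N} k) =
        (\<Sum>k<N. (1 - s ^ k) * pmf p k)"
      by (subst integral_measure_pmf_real[where A = "{..<N}"]) (auto simp: indicator_def)
    have "integrable (measure_pmf p) (\<lambda>k. (1 - s ^ k) * indicator {..<N} k)"
      using s by (intro measure_pmf.integrable_const_bound[where B=1])
        (auto simp: indicator_def power_le_one)
    thus ?thesis using s
      by (subst Bochner_Integration.integral_add) (auto simp: integrable_pow_pmf 1 pgf_def)
  qed
  also have "\<dots> \<le> measure_pmf.expectation p (\<lambda>k. 1)"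
    using s by (intro integral_mono measure_pmf.integrable_const_bound[where B=1])
      (auto simp: indicator_def power_le_one)
  finally have "pgf p s + (\<Sum>k<N. (1 - s ^ k) * pmf p k) \<le> 1" by simp
  with \<open>\<phi> s > 0\<close> s show ?thesis unfolding \<phi>_def by (intro exI[of _ s]) auto
qed

lemma pgf_pos:
  assumes "0 < s" "s \<le> 1"
  shows "pgf p s > 0"
proof -
  obtain k where k: "k \<in> set_pmf p" using set_pmf_not_empty[of p] by auto
  have "0 < s ^ k * pmf p k" using assms k by (simp add: pmf_positive)
  also have "\<dots> = measure_pmf.expectation p (\<lambda>j. s ^ j * indicator {k} j)"
    by (subst integral_measure_pmf_real[where A = "{k}"]) (auto simp: indicator_def)
  also have "\<dots> \<le> pgf p s"
    unfolding pgf_def using assms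
    by (intro integral_mono measure_pmf.integrable_const_bound[where B=1])
       (auto simp: indicator_def power_le_one)
  finally show ?thesis .
qed

lemma supercritical_parameters:
  assumes "supercritical p"
  shows "\<exists>x y z. x > 1 \<and> 0 < y \<and> y < 1 \<and> 0 < z \<and>
           (\<integral>\<^sup>+k. ennreal (x * (y + z) ^ k) \<partial>measure_pmf p) \<le> ennreal z"
proof -
  obtain s where s: "0 < s" "s < 1" "pgf p s < s"
    using supercritical_pgf_less[OF assms] by blast
  have pos: "pgf p s > 0" using s by (intro pgf_pos) auto
  define y where "y = (s - pgf p s) / 2"
  define z where "z = s - y"
  define x where "x = z / pgf p s"
  have z: "pgf p s < z" "0 < z" "0 < y" "y < 1" "y + z = s"
    using s pos by (auto simp: z_def y_def field_simps)
  have x: "x > 1" using z pos by (auto simp: x_def)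
  have "(\<integral>\<^sup>+k. ennreal (x * s ^ k) \<partial>measure_pmf p) = ennreal (\<integral>k. x * s ^ k \<partial>measure_pmf p)"
    using s x by (intro nn_integral_eq_integral integrable_mult_right integrable_pow_pmf) auto
  also have "\<dots> = ennreal z" using pos by (simp add: x_def flip: pgf_def)
  finally have "(\<integral>\<^sup>+k. ennreal (x * (y + z) ^ k) \<partial>measure_pmf p) \<le> ennreal z"
    using z by simp
  with x z show ?thesis by blast
qed

section \<open>The expected total weight of the finite subtrees\<close>

text \<open>For \<open>x, y \<ge> 0\<close> and a finite subtree \<open>S\<close> of the family tree of \<open>c\<close> that contains the root, this is
  \<open>x ^ |S| * y ^ |\<partial>S|\<close>; for other finite sets with \<open>rooted_subtree S\<close> it is 0.\<close>

definition subtree_weight :: "real \<Rightarrow> real \<Rightarrow> (nat list \<Rightarrow> nat) \<Rightarrow> nat list set \<Rightarrow> ennreal" where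
  "subtree_weight x y c S = (\<Prod>v\<in>S. offspring_weight x y (child_set S v) (c v))"

lemma (in prob_space) nn_integral_offspring:
  assumes "distr M (count_space UNIV) X = measure_pmf p"
    and [measurable]: "X \<in> measurable M (count_space UNIV)"
  shows "(\<integral>\<^sup>+\<omega>. f (X \<omega>) \<partial>M) = (\<integral>\<^sup>+k. f k \<partial>measure_pmf p)"
proof -
  have "(\<integral>\<^sup>+\<omega>. f (X \<omega>) \<partial>M) = (\<integral>\<^sup>+k. f k \<partial>distr M (count_space UNIV) X)"
    by (subst nn_integral_distr) auto
  thus ?thesis by (simp add: assms)
qed

lemma galton_watson_measurable:
  assumes "galton_watson M p \<xi>"
  shows "\<xi> v \<in> measurable M (count_space UNIV)"
proof -
  have "prob_space M" "prob_space.indep_vars M (\<lambda>_. count_space UNIV) \<xi> UNIV"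
    using assms by (simp_all add: galton_watson_def)
  thus ?thesis by (simp add: prob_space.indep_vars_def2)
qed

lemma measurable_subtree_weight:
  assumes "galton_watson M p \<xi>"
  shows "(\<lambda>\<omega>. subtree_weight x y (\<lambda>v. \<xi> v \<omega>) S) \<in> borel_measurable M"
proof -
  note [measurable] = galton_watson_measurable[OF assms]
  show ?thesis unfolding subtree_weight_def by measurable
qed

lemma nn_integral_subtree_weight:
  assumes gw: "galton_watson M p \<xi>" and "finite S"
  shows "(\<integral>\<^sup>+\<omega>. subtree_weight x y (\<lambda>v. \<xi> v \<omega>) S \<partial>M) =
    (\<Prod>v\<in>S. \<integral>\<^sup>+k. offspring_weight x y (child_set S v) k \<partial>measure_pmf p)"
proof -
  interpret prob_space M using gw by (simp add: galton_watson_def)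
  have ind: "indep_vars (\<lambda>_. count_space UNIV) \<xi> UNIV"
    and law: "\<And>v. distr M (count_space UNIV) (\<xi> v) = measure_pmf p"
    using gw by (auto simp: galton_watson_def)
  have "indep_vars (\<lambda>_. borel) (\<lambda>v \<omega>. offspring_weight x y (child_set S v) (\<xi> v \<omega>)) S"
    by (rule indep_vars_compose2[OF indep_vars_subset[OF ind]]) auto
  hence "(\<integral>\<^sup>+\<omega>. subtree_weight x y (\<lambda>v. \<xi> v \<omega>) S \<partial>M) =
      (\<Prod>v\<in>S. \<integral>\<^sup>+\<omega>. offspring_weight x y (child_set S v) (\<xi> v \<omega>) \<partial>M)"
    unfolding subtree_weight_def by (intro indep_vars_nn_integral assms) auto
  thus ?thesis by (simp add: nn_integral_offspring[OF law galton_watson_measurable[OF gw]])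
qed

lemma AE_sum_subtree_weight_finite:
  assumes gw: "galton_watson M p \<xi>" and "x \<ge> 0" "y \<ge> 0" "z \<ge> 0"
    and z: "(\<integral>\<^sup>+k. ennreal (x * (y + z) ^ k) \<partial>measure_pmf p) \<le> ennreal z"
  shows "AE \<omega> in M. (SUP n. \<Sum>S\<in>bounded_subtrees n n. subtree_weight x y (\<lambda>v. \<xi> v \<omega>) S) \<noteq> \<infinity>"
proof (rule nn_integral_PInf_AE)
  note [measurable] = measurable_subtree_weight[OF gw]
  define g where "g D = (\<integral>\<^sup>+k. offspring_weight x y D k \<partial>measure_pmf p)" for D
  have g: "(\<Sum>D\<in>Pow {..<w}. g D * ennreal z ^ card D) \<le> ennreal z" for w
  proof -
    have "(\<Sum>D\<in>Pow {..<w}. g D * ennreal z ^ card D) =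
        (\<integral>\<^sup>+k. (\<Sum>D\<in>Pow {..<w}. offspring_weight x y D k * ennreal z ^ card D) \<partial>measure_pmf p)"
      by (simp add: g_def nn_integral_sum nn_integral_multc)
    also have "\<dots> \<le> (\<integral>\<^sup>+k. ennreal (x * (y + z) ^ k) \<partial>measure_pmf p)"
      using assms by (intro nn_integral_mono sum_offspring_weight_le)
    finally show ?thesis using z by (rule order_trans)
  qed
  let ?Z = "\<lambda>n \<omega>. \<Sum>S\<in>bounded_subtrees n n. subtree_weight x y (\<lambda>v. \<xi> v \<omega>) S"
  show "(\<lambda>\<omega>. SUP n. ?Z n \<omega>) \<in> borel_measurable M" by measurable
  have "incseq ?Z"
    by (intro incseq_SucI le_funI sum_mono2 bounded_subtrees_mono finite_bounded_subtrees) auto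
  hence "(\<integral>\<^sup>+\<omega>. (SUP n. ?Z n \<omega>) \<partial>M) = (SUP n. \<integral>\<^sup>+\<omega>. ?Z n \<omega> \<partial>M)"
    by (rule nn_integral_monotone_convergence_SUP) measurable
  also have "\<dots> \<le> ennreal z"
  proof (rule SUP_least)
    fix n
    have "(\<integral>\<^sup>+\<omega>. ?Z n \<omega> \<partial>M) = (\<Sum>S\<in>bounded_subtrees n n. \<Prod>v\<in>S. g (child_set S v))"
      unfolding g_def
      by (subst nn_integral_sum)
         (auto intro!: sum.cong nn_integral_subtree_weight[OF gw] finite_if_in_bounded_subtrees)
    also have "\<dots> \<le> ennreal z" by (intro sum_bounded_subtrees_le g)
    finally show "(\<integral>\<^sup>+\<omega>. ?Z n \<omega> \<partial>M) \<le> ennreal z" .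
  qed
  finally show "(\<integral>\<^sup>+\<omega>. (SUP n. ?Z n \<omega>) \<partial>M) \<noteq> \<infinity>"
    by (metis ennreal_less_top infinity_ennreal_def leD)
qed

section \<open>Boundaries of finite subtrees of a family tree\<close>

lemma family_tree_snocD: "v @ [i] \<in> family_tree c \<Longrightarrow> v \<in> family_tree c \<and> i < c v"
  by (cases rule: family_tree.cases) auto

lemma connected_imp_rooted_subtree:
  assumes root: "[] \<in> S" and conn: "induces_connected (family_edges c) S"
  shows "rooted_subtree S"
  unfolding rooted_subtree_def
proof (intro conjI allI impI root)
  fix v i assume vi: "v @ [i] \<in> S"
  show "v \<in> S"
  proof (rule ccontr)
    assume v: "v \<notin> S"
    \<comment> \<open>A path inside \<open>S\<close> from \<open>v @ [i]\<close> could leave the descendants of \<open>v @ [i]\<close> only through \<open>v\<close>.\<close>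
    have descend: "prefix (v @ [i]) u"
      if "(v @ [i], u) \<in> {(a, b). a \<in> S \<and> b \<in> S \<and> {a, b} \<in> family_edges c}\<^sup>*" for u
      using that
    proof (induction rule: rtrancl_induct)
      case (step a b)
      then obtain u j where "{a, b} = {u, u @ [j]}" by (auto simp: family_edges_def)
      with step v show ?case by (auto simp: doubleton_eq_iff prefix_snoc)
    qed simp
    have "prefix (v @ [i]) []"
      using conn vi root by (intro descend) (auto simp: induces_connected_def)
    thus False by simp
  qed
qed

text \<open>The edges to those children of vertices of \<open>S\<close> that are not in \<open>S\<close> are distinct boundary edges.
  (If \<open>S\<close> is closed under taking parents, there are no others, but the lower bound suffices.)\<close>

lemma edge_boundary_ge:
  assumes S: "finite S" "S \<subseteq> family_tree c"
  shows "of_nat (\<Sum>v\<in>S. c v - card (child_set S v))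
           \<le> emeasure (count_space UNIV) (edge_boundary (family_tree c) (family_edges c) S)"
proof -
  let ?I = "SIGMA v:S. {..<c v} - child_set S v"
  let ?B = "(\<lambda>(v, i). {v, v @ [i]}) ` ?I"
  have child: "child_set S v \<subseteq> {..<c v}" for v
    using S(2) by (auto simp: child_set_def dest: family_tree_snocD)
  have "inj_on (\<lambda>(v, i :: nat). {v, v @ [i]}) ?I"
    by (auto simp: inj_on_def doubleton_eq_iff)
  hence "card ?B = card ?I" by (rule card_image)
  also have "\<dots> = (\<Sum>v\<in>S. card ({..<c v} - child_set S v))"
    using S by (subst card_SigmaI) auto
  also have "\<dots> = (\<Sum>v\<in>S. c v - card (child_set S v))"
    using finite_subset[OF child] child by (intro sum.cong refl) (simp add: card_Diff_subset)
  finally have "of_nat (\<Sum>v\<in>S. c v - card (child_set S v)) = emeasure (count_space UNIV) ?B"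
    using S by (subst emeasure_count_space_finite) auto
  also have "?B \<subseteq> edge_boundary (family_tree c) (family_edges c) S"
  proof safe
    fix v i assume vi: "v \<in> S" "i < c v" "i \<notin> child_set S v"
    hence "v \<in> family_tree c" "v @ [i] \<in> family_tree c - S"
      using S by (auto simp: child_set_def intro: family_tree.child)
    with vi show "{v, v @ [i]} \<in> edge_boundary (family_tree c) (family_edges c) S"
      unfolding edge_boundary_def family_edges_def by blast
  qed
  hence "emeasure (count_space UNIV) ?B
      \<le> emeasure (count_space UNIV) (edge_boundary (family_tree c) (family_edges c) S)"
    by (rule emeasure_mono) simp
  finally show ?thesis .
qed

lemma subtree_weight_eq:
  assumes "S \<subseteq> family_tree c" "0 \<le> x" "0 \<le> y"
  shows "subtree_weight x y c S =
           ennreal (x ^ card S * y ^ (\<Sum>v\<in>S. c v - card (child_set S v)))"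
proof -
  have child: "child_set S v \<subseteq> {..<c v}" for v
    using assms by (auto simp: child_set_def dest: family_tree_snocD)
  have "subtree_weight x y c S = ennreal (\<Prod>v\<in>S. x * y ^ (c v - card (child_set S v)))"
    using assms child by (simp add: subtree_weight_def offspring_weight_def prod_ennreal)
  thus ?thesis by (simp add: prod.distrib power_sum)
qed

section \<open>From summable weights to anchored expansion\<close>

lemma finite_if_sum_weights_finite:
  fixes f :: "nat list set \<Rightarrow> ennreal"
  assumes sup: "(SUP n. \<Sum>S\<in>bounded_subtrees n n. f S) \<noteq> \<infinity>"
    and B: "\<And>S. S \<in> B \<Longrightarrow> rooted_subtree S \<and> finite S \<and> 1 \<le> f S"
  shows "finite B"
proof (rule ccontr)
  assume "infinite B"
  obtain m :: nat where m: "(SUP n. \<Sum>S\<in>bounded_subtrees n n. f S) < of_nat m"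
    using sup ennreal_Ex_less_of_nat less_top by (metis infinity_ennreal_def)
  obtain F where F: "finite F" "card F = m" "F \<subseteq> B"
    using infinite_arbitrarily_large[OF \<open>infinite B\<close>] by blast
  have "\<forall>S\<in>F. \<exists>n. S \<in> bounded_subtrees n n"
    using B F finite_rooted_subtree_in_bounded_subtrees by blast
  then obtain N where N: "\<And>S. S \<in> F \<Longrightarrow> S \<in> bounded_subtrees (N S) (N S)" by metis
  define n where "n = Max (insert 0 (N ` F))"
  have F_sub: "F \<subseteq> bounded_subtrees n n"
  proof
    fix S assume "S \<in> F"
    hence "N S \<le> n" using F by (auto simp: n_def intro!: Max_ge)
    thus "S \<in> bounded_subtrees n n" using N[OF \<open>S \<in> F\<close>] bounded_subtrees_mono by blast
  qed
  have "of_nat m = (\<Sum>S\<in>F. 1 :: ennreal)" using F by simp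
  also have "\<dots> \<le> (\<Sum>S\<in>F. f S)" using B F by (intro sum_mono) auto
  also have "\<dots> \<le> (\<Sum>S\<in>bounded_subtrees n n. f S)"
    using F_sub by (intro sum_mono2 finite_bounded_subtrees) auto
  also have "\<dots> \<le> (SUP n. \<Sum>S\<in>bounded_subtrees n n. f S)" by (rule SUP_upper) simp
  finally show False using m by simp
qed

text \<open>The infima increase with the size, so a lower bound from one size on bounds the limit.\<close>

lemma anchored_expansion_ge:
  assumes "\<And>S. b \<in> S \<Longrightarrow> S \<subseteq> V \<Longrightarrow> induces_connected E S \<Longrightarrow> finite S \<Longrightarrow> n \<le> card S \<Longrightarrow>
             a \<le> emeasure (count_space UNIV) (edge_boundary V E S) / of_nat (card S)"
  shows "a \<le> anchored_expansion V E b"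
proof -
  define g where "g m = (INF S \<in> {S. b \<in> S \<and> S \<subseteq> V \<and> induces_connected E S \<and> finite S \<and> m \<le> card S}.
      emeasure (count_space UNIV) (edge_boundary V E S) / of_nat (card S))" for m
  have "incseq g" unfolding g_def by (intro incseq_SucI INF_superset_mono) auto
  hence "lim g = (SUP m. g m)" by (intro limI LIMSEQ_SUP)
  moreover have "a \<le> g n" unfolding g_def using assms by (intro INF_greatest) auto
  ultimately have "a \<le> lim g" by (simp add: SUP_upper2)
  thus ?thesis by (simp add: anchored_expansion_def g_def[abs_def])
qed

lemma anchored_expansion_pos:
  assumes x: "x > 1" and y: "0 < y" "y < 1"
    and sup: "(SUP n. \<Sum>S\<in>bounded_subtrees n n. subtree_weight x y c S) \<noteq> \<infinity>"
  shows "anchored_expansion (family_tree c) (family_edges c) [] > 0"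
proof -
  let ?b = "\<lambda>S. \<Sum>v\<in>S. c v - card (child_set S v)"
  obtain K where "1 / y < x ^ K" using x real_arch_pow by blast
  hence K: "1 \<le> x ^ K * y" using y by (simp add: field_simps)
  have "K > 0" using \<open>1 / y < x ^ K\<close> y by (intro Nat.gr0I) (auto simp: field_simps)
  \<comment> \<open>The subtrees whose boundary is too small.\<close>
  define B where "B = {S. rooted_subtree S \<and> finite S \<and> S \<subseteq> family_tree c \<and> K * ?b S \<le> card S}"
  have "finite B"
  proof (rule finite_if_sum_weights_finite[OF sup])
    fix S assume S: "S \<in> B"
    have "1 \<le> (x ^ K * y) ^ ?b S" using K by (rule one_le_power)
    also have "\<dots> = x ^ (K * ?b S) * y ^ ?b S" by (simp add: power_mult_distrib power_mult)
    also have "\<dots> \<le> x ^ card S * y ^ ?b S"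
      using S x y by (intro mult_right_mono power_increasing) (auto simp: B_def)
    finally have "1 \<le> subtree_weight x y c S"
      using S x y by (subst subtree_weight_eq) (auto simp: B_def)
    with S show "rooted_subtree S \<and> finite S \<and> 1 \<le> subtree_weight x y c S"
      by (simp add: B_def)
  qed
  define n where "n = Suc (Max (insert 0 (card ` B)))"
  have "ennreal (1 / K) \<le> anchored_expansion (family_tree c) (family_edges c) []"
  proof (rule anchored_expansion_ge)
    fix S assume S: "[] \<in> S" "S \<subseteq> family_tree c" "induces_connected (family_edges c) S"
      "finite S" "n \<le> card S"
    have "card S \<le> Max (insert 0 (card ` B))" if "S \<in> B"
      using that \<open>finite B\<close> by (intro Max_ge) auto
    hence "S \<notin> B" using S(5) by (auto simp: n_def)
    hence "card S < K * ?b S"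
      using S connected_imp_rooted_subtree by (auto simp: B_def)
    hence "real (card S) < real K * real (?b S)" by (metis of_nat_less_iff of_nat_mult)
    moreover have "card S > 0" using S(5) by (simp add: n_def)
    ultimately have "1 / K \<le> real (?b S) / real (card S)"
      using \<open>K > 0\<close> by (simp add: field_simps)
    hence "ennreal (1 / K) \<le> ennreal (real (?b S) / real (card S))" by (rule ennreal_leI)
    also have "\<dots> = of_nat (?b S) / of_nat (card S)"
      using \<open>card S > 0\<close> by (simp add: ennreal_of_nat_eq_real_of_nat divide_ennreal del: of_nat_sum)
    also have "\<dots> \<le> emeasure (count_space UNIV)
        (edge_boundary (family_tree c) (family_edges c) S) / of_nat (card S)"
      using S by (intro divide_right_mono_ennreal edge_boundary_ge)
    finally show "ennreal (1 / K) \<le> emeasure (count_space UNIV)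
        (edge_boundary (family_tree c) (family_edges c) S) / of_nat (card S)" .
  qed
  moreover have "0 < ennreal (1 / K)" using \<open>K > 0\<close> by simp
  ultimately show ?thesis by (metis less_le_trans)
qed

section \<open>The event of nonextinction and the conclusion\<close>

lemma family_tree_iff: "v \<in> family_tree c \<longleftrightarrow> (\<forall>k<length v. v ! k < c (take k v))"
proof (induction v rule: rev_induct)
  case Nil
  show ?case by (simp add: family_tree.root)
next
  case (snoc i v)
  have "v @ [i] \<in> family_tree c \<longleftrightarrow> v \<in> family_tree c \<and> i < c v"
    using family_tree_snocD family_tree.child by blast
  thus ?case unfolding snoc.IH by (auto simp: nth_append less_Suc_eq)
qed

lemma sets_infinite_family_tree:
  assumes "galton_watson M p \<xi>"
  shows "{\<omega> \<in> space M. infinite (family_tree (\<lambda>v. \<xi> v \<omega>))} \<in> sets M"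
proof -
  note [measurable] = galton_watson_measurable[OF assms]
  have "infinite T \<longleftrightarrow> (\<forall>F. \<exists>v. v \<in> T \<and> v \<notin> set F)" for T :: "nat list set"
    by (metis finite_list finite_set rev_finite_subset subsetI)
  hence eq: "infinite (family_tree (\<lambda>v. \<xi> v \<omega>)) \<longleftrightarrow>
      (\<forall>F. \<exists>v. (\<forall>k<length v. v ! k < \<xi> (take k v) \<omega>) \<and> v \<notin> set F)" for \<omega>
    by (simp only: family_tree_iff)
  show ?thesis unfolding eq by measurable
qed

theorem corollary1p3:
  fixes M :: "'w measure" and p :: "nat pmf" and \<xi> :: "nat list \<Rightarrow> 'w \<Rightarrow> nat"
  assumes "galton_watson M p \<xi>" and "supercritical p"
  shows "AE \<omega> in uniform_measure M {\<omega> \<in> space M. infinite (family_tree (\<lambda>v. \<xi> v \<omega>))}.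
           anchored_expansion (family_tree (\<lambda>v. \<xi> v \<omega>)) (family_edges (\<lambda>v. \<xi> v \<omega>)) [] > 0"
proof (rule AE_uniform_measureI)
  show "{\<omega> \<in> space M. infinite (family_tree (\<lambda>v. \<xi> v \<omega>))} \<in> sets M"
    using assms(1) by (rule sets_infinite_family_tree)
  obtain x y z :: real where xyz: "x > 1" "0 < y" "y < 1" "0 < z"
    "(\<integral>\<^sup>+k. ennreal (x * (y + z) ^ k) \<partial>measure_pmf p) \<le> ennreal z"
    using supercritical_parameters[OF assms(2)] by blast
  have "AE \<omega> in M. (SUP n. \<Sum>S\<in>bounded_subtrees n n. subtree_weight x y (\<lambda>v. \<xi> v \<omega>) S) \<noteq> \<infinity>"
    using xyz by (intro AE_sum_subtree_weight_finite[OF assms(1), where z = z]) auto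
  thus "AE \<omega> in M. \<omega> \<in> {\<omega> \<in> space M. infinite (family_tree (\<lambda>v. \<xi> v \<omega>))} \<longrightarrow>
      anchored_expansion (family_tree (\<lambda>v. \<xi> v \<omega>)) (family_edges (\<lambda>v. \<xi> v \<omega>)) [] > 0"
    by eventually_elim (use xyz anchored_expansion_pos in blast)
qed

end
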